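(* Let $n\ge 1$. Modulo the axioms $x_{ij}^2=x_{ij}$ and $x_{ij}x_{ji}=0$ for all distinct $i,j\in[n]$ (where $x_{ji}=1-x_{ij}$), the following equality holds: $$-1=\sum_{m=1}^{n-1}\left(\left(F_{(m+1)(m+1)}-\sum_{j=1}^mF_{jm}F_{(m+1)(m+1)}\right)^2-\sum_{j=1}^m\sum_{k\in[m]\setminus\{j\}}T_{jmk}\right)-\sum_{j=1}^nF_{jn},$$ and it gives a sum of squares proof that the axioms of the ordering principle system $\mathrm{ORD}_n$ are infeasible (that is, each $T_{jmk}$ is a monomial multiple of a transitivity axiom and each $F_{jn}$ is a non-minimality axiom).
   Context: Ordering principle system $\mathrm{ORD}_n$: there is a Boolean variable $x_{ij}$ for each $i,j\in[n]$ with $i<j$; for $i<j$ write $x_{ji}=1-x_{ij}$. The axioms are: for each $i\in[n]$, $\prod_{j\in[n]\setminus\{i\}}x_{ij}=0$ (non-minimality axioms); and for each $i<j<k$ in $[n]$, $x_{ij}x_{jk}x_{ki}=0$ and $x_{kj}x_{ji}x_{ik}=0$ (transitivity axioms). For $1\le j\le m\le n$, $F_{jm}=\prod_{i\in[m]\setminus\{j\}}x_{ji}$ (an empty product is $1$). For $m\in[n-1]$ and distinct $j,k\in[m]$, $$T_{jmk}=F_{jm}\,x_{(m+1)j}\,x_{k(m+1)}\prod_{i\in[k-1]\setminus\{j\}}x_{(m+1)i}.$$ A sum of squares proof of infeasibility of axioms $\{p_i=0\}$ is an equality $-1=\sum_ip_iq_i+\sum_jg_j^2$ (here modulo the Boolean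 axioms) with real polynomials $q_i,g_j$. *)

theory Defs
  imports Complex_Main "HOL-Library.Poly_Mapping"
begin

text \<open>
  Real multivariate polynomials with variables of type \<open>'v\<close>, as finitely supported maps from
  monomials (finitely supported exponent functions) to coefficients.
\<close>

type_synonym 'v rpoly = "('v \<Rightarrow>\<^sub>0 nat) \<Rightarrow>\<^sub>0 real"

definition var :: "'v \<Rightarrow> 'v rpoly"
  where "var v = Poly_Mapping.single (Poly_Mapping.single v 1) 1"

definition polys_in :: "'v set \<Rightarrow> 'v rpoly set"
  where "polys_in V = {p. \<forall>m \<in> Poly_Mapping.keys p. Poly_Mapping.keys m \<subseteq> V}"

text \<open>
  Congruence of polynomials modulo the ideal generated by \<open>B\<close> in the polynomial ring over the
  variables \<open>V\<close>. Since it uses a sum over \<open>B\<close>, it is meant for finite \<open>B\<close> only.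
\<close>

definition cong_modulo :: "'v set \<Rightarrow> 'v rpoly set \<Rightarrow> 'v rpoly \<Rightarrow> 'v rpoly \<Rightarrow> bool"
  where "cong_modulo V B p q \<longleftrightarrow>
    (\<exists>c. (\<forall>b\<in>B. c b \<in> polys_in V) \<and> p - q = (\<Sum>b\<in>B. b * c b))"

text \<open>
  The multipliers \<open>q\<close> and the list \<open>gs\<close> form a sum of squares proof, modulo \<open>B\<close>, of the
  infeasibility of the (finitely many) axioms \<open>p = 0\<close> with \<open>p \<in> A\<close>.
\<close>

definition sos_proof ::
    "'v set \<Rightarrow> 'v rpoly set \<Rightarrow> 'v rpoly set \<Rightarrow> ('v rpoly \<Rightarrow> 'v rpoly) \<Rightarrow> 'v rpoly list \<Rightarrow> bool"
  where "sos_proof V B A q gs \<longleftrightarrow>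
    (\<forall>p\<in>A. q p \<in> polys_in V) \<and> set gs \<subseteq> polys_in V \<and>
    cong_modulo V B (- 1) ((\<Sum>p\<in>A. p * q p) + (\<Sum>g\<leftarrow>gs. g\<^sup>2))"

definition ord_vars :: "nat \<Rightarrow> (nat \<times> nat) set"
  where "ord_vars n = {(i, j). 1 \<le> i \<and> i < j \<and> j \<le> n}"

text \<open>
  Only pairs \<open>(i, j)\<close> with \<open>i < j\<close> are variables; \<open>x j i\<close> is \<open>1 - x i j\<close>. The value \<open>x i i\<close> is junk
  and never used.
\<close>

definition x :: "nat \<Rightarrow> nat \<Rightarrow> (nat \<times> nat) rpoly"
  where "x i j = (if i < j then var (i, j) else 1 - var (j, i))"

definition boolean_axioms :: "nat \<Rightarrow> (nat \<times> nat) rpoly set"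
  where "boolean_axioms n =
    {(x i j)\<^sup>2 - x i j | i j. i \<in> {1..n} \<and> j \<in> {1..n} \<and> i \<noteq> j} \<union>
    {x i j * x j i | i j. i \<in> {1..n} \<and> j \<in> {1..n} \<and> i \<noteq> j}"

definition non_minimality_axioms :: "nat \<Rightarrow> (nat \<times> nat) rpoly set"
  where "non_minimality_axioms n = {(\<Prod>j\<in>{1..n} - {i}. x i j) | i. i \<in> {1..n}}"

definition transitivity_axioms :: "nat \<Rightarrow> (nat \<times> nat) rpoly set"
  where "transitivity_axioms n =
    {x i j * x j k * x k i | i j k. 1 \<le> i \<and> i < j \<and> j < k \<and> k \<le> n} \<union>
    {x k j * x j i * x i k | i j k. 1 \<le> i \<and> i < j \<and> j < k \<and> k \<le> n}"

definition ORD :: "nat \<Rightarrow> (nat \<times> nat) rpoly set"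
  where "ORD n = non_minimality_axioms n \<union> transitivity_axioms n"

text \<open>
  Monomials in all the \<open>x i j\<close> with \<open>i \<noteq> j\<close>, that is, products of powers of variables and of
  their complements.
\<close>

definition literal_monomial :: "nat \<Rightarrow> (nat \<times> nat) rpoly \<Rightarrow> bool"
  where "literal_monomial n M \<longleftrightarrow>
    (\<exists>e :: nat \<Rightarrow> nat \<Rightarrow> nat. M = (\<Prod>i\<in>{1..n}. \<Prod>j\<in>{1..n} - {i}. x i j ^ e i j))"

definition F :: "nat \<Rightarrow> nat \<Rightarrow> (nat \<times> nat) rpoly"
  where "F j m = (\<Prod>i\<in>{1..m} - {j}. x j i)"

definition T :: "nat \<Rightarrow> nat \<Rightarrow> nat \<Rightarrow> (nat \<times> nat) rpoly"
  where "T j m k =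
    F j m * x (m + 1) j * x k (m + 1) * (\<Prod>i\<in>{1..k - 1} - {j}. x (m + 1) i)"

end

theory Submission
  imports Defs
begin

text \<open>
  Write \<open>G = F (m + 1) (m + 1)\<close> and \<open>S = (\<Sum>j = 1..m. F j m)\<close>. Summing over the least \<open>k\<close> with
  \<open>x k (m + 1) = 1\<close> gives \<open>(\<Sum>k. T j m k) = F j m * x (m + 1) j - F j m * G\<close>, while
  \<open>F j m = F j (m + 1) + F j m * x (m + 1) j\<close>. Both are identities of polynomials, and they turn
  \<open>G * (1 - S) - (\<Sum>j. \<Sum>k. T j m k)\<close> into the increment of \<open>S\<close> from \<open>m\<close> to \<open>m + 1\<close>, which
  telescopes to \<open>(\<Sum>j = 1..n. F j n) - 1\<close>. Modulo the Boolean axioms, \<open>G\<close> is idempotent and the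
  \<open>F j m\<close> are orthogonal idempotents, so \<open>(G * (1 - S))\<^sup>2\<close> and \<open>G * (1 - S)\<close> are congruent.
\<close>

subsection \<open>Polynomials in a given set of variables and their ideals\<close>

lemma zero_in_polys_in [simp]: "0 \<in> polys_in V"
  by (simp add: polys_in_def)

lemma one_in_polys_in [simp]: "1 \<in> polys_in V"
  by (simp add: polys_in_def)

lemma var_in_polys_in: "v \<in> V \<Longrightarrow> var v \<in> polys_in V"
  by (simp add: polys_in_def var_def)

lemma add_in_polys_in: "p \<in> polys_in V \<Longrightarrow> q \<in> polys_in V \<Longrightarrow> p + q \<in> polys_in V"
  using Poly_Mapping.keys_add[of p q] by (fastforce simp: polys_in_def)

lemma uminus_in_polys_in: "p \<in> polys_in V \<Longrightarrow> - p \<in> polys_in V"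
  by (simp add: polys_in_def)

lemma diff_in_polys_in: "p \<in> polys_in V \<Longrightarrow> q \<in> polys_in V \<Longrightarrow> p - q \<in> polys_in V"
  using add_in_polys_in[of p V "- q"] by (simp add: uminus_in_polys_in)

lemma mult_in_polys_in:
  assumes "p \<in> polys_in V" "q \<in> polys_in V"
  shows "p * q \<in> polys_in V"
  unfolding polys_in_def
proof (clarify)
  fix m v
  assume "m \<in> Poly_Mapping.keys (p * q)" "v \<in> Poly_Mapping.keys m"
  moreover from this obtain a b where "m = a + b"
      "a \<in> Poly_Mapping.keys p" "b \<in> Poly_Mapping.keys q"
    using keys_mult[of p q] by blast
  ultimately show "v \<in> V"
    using assms Poly_Mapping.keys_add[of a b] unfolding polys_in_def by blast
qed

lemma sum_in_polys_in: "(\<And>i. i \<in> I \<Longrightarrow> f i \<in> polys_in V) \<Longrightarrow> sum f I \<in> polys_in V"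
  by (induction I rule: infinite_finite_induct) (auto intro: add_in_polys_in)

lemma prod_in_polys_in: "(\<And>i. i \<in> I \<Longrightarrow> f i \<in> polys_in V) \<Longrightarrow> prod f I \<in> polys_in V"
  by (induction I rule: infinite_finite_induct) (auto intro: mult_in_polys_in)

lemma power_in_polys_in: "p \<in> polys_in V \<Longrightarrow> p ^ k \<in> polys_in V"
  by (induction k) (auto intro: mult_in_polys_in)

text \<open>For finite \<open>B\<close> this is the ideal generated by \<open>B\<close> over the
  variables \<open>V\<close>. With the Boolean axioms it expresses congruence; with
  \<open>ORD n\<close> its coefficient functions \<open>c\<close> supply the multipliers
  \<open>q\<close>.\<close>

definition ideal_in :: "'v set \<Rightarrow> 'v rpoly set \<Rightarrow> 'v rpoly set"
  where "ideal_in V B = {\<Sum>b\<in>B. b * c b | c. \<forall>b\<in>B. c b \<in> polys_in V}"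

lemma cong_modulo_iff: "cong_modulo V B p q \<longleftrightarrow> p - q \<in> ideal_in V B"
  by (auto simp: cong_modulo_def ideal_in_def)

lemma zero_in_ideal_in [simp]: "0 \<in> ideal_in V B"
  unfolding ideal_in_def by (auto intro!: exI[of _ "\<lambda>_. 0"])

lemma add_in_ideal_in:
  assumes "p \<in> ideal_in V B" "q \<in> ideal_in V B"
  shows "p + q \<in> ideal_in V B"
proof -
  obtain c d where "\<forall>b\<in>B. c b \<in> polys_in V" "p = (\<Sum>b\<in>B. b * c b)"
      "\<forall>b\<in>B. d b \<in> polys_in V" "q = (\<Sum>b\<in>B. b * d b)"
    using assms unfolding ideal_in_def by blast
  then show ?thesis
    unfolding ideal_in_def
    by (auto simp: sum.distrib distrib_left add_in_polys_in intro!: exI[of _ "\<lambda>b. c b + d b"])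
qed

lemma mult_in_ideal_in:
  assumes "p \<in> ideal_in V B" "a \<in> polys_in V"
  shows "a * p \<in> ideal_in V B"
proof -
  obtain c where "\<forall>b\<in>B. c b \<in> polys_in V" "p = (\<Sum>b\<in>B. b * c b)"
    using assms unfolding ideal_in_def by blast
  then show ?thesis
    using assms(2) unfolding ideal_in_def
    by (auto simp: sum_distrib_left mult_in_polys_in ac_simps intro!: exI[of _ "\<lambda>b. a * c b"])
qed

lemma uminus_in_ideal_in: "p \<in> ideal_in V B \<Longrightarrow> - p \<in> ideal_in V B"
  using mult_in_ideal_in[of p V B "- 1"] by (simp add: uminus_in_polys_in)

lemma diff_in_ideal_in: "p \<in> ideal_in V B \<Longrightarrow> q \<in> ideal_in V B \<Longrightarrow> p - q \<in> ideal_in V B"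
  using add_in_ideal_in[of p V B "- q"] by (simp add: uminus_in_ideal_in)

lemma sum_in_ideal_in: "(\<And>i. i \<in> I \<Longrightarrow> f i \<in> ideal_in V B) \<Longrightarrow> sum f I \<in> ideal_in V B"
  by (induction I rule: infinite_finite_induct) (auto intro: add_in_ideal_in)

lemma generator_in_ideal_in:
  assumes "finite B" "b \<in> B"
  shows "b \<in> ideal_in V B"
proof -
  have "b = (\<Sum>b'\<in>B. b' * (if b' = b then 1 else 0))"
    using assms by (simp add: if_distrib[of "\<lambda>t. _ * t"] cong: if_cong)
  then show ?thesis
    unfolding ideal_in_def by (auto intro!: exI[of _ "\<lambda>b'. if b' = b then 1 else 0"])
qed

section \<open>Idempotents modulo an ideal\<close>

lemma mult_idempotent_in_ideal_in:
  assumes "a\<^sup>2 - a \<in> ideal_in V B" "b\<^sup>2 - b \<in> ideal_in V B" "a \<in> polys_in V" "b \<in> polys_in V"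
  shows "(a * b)\<^sup>2 - a * b \<in> ideal_in V B"
proof -
  have "(a * b)\<^sup>2 - a * b = a\<^sup>2 * (b\<^sup>2 - b) + b * (a\<^sup>2 - a)"
    by (simp add: algebra_simps power2_eq_square)
  then show ?thesis
    using assms by (simp add: add_in_ideal_in mult_in_ideal_in power_in_polys_in)
qed

lemma prod_idempotent_in_ideal_in:
  assumes "\<And>i. i \<in> I \<Longrightarrow> f i \<in> polys_in V" "\<And>i. i \<in> I \<Longrightarrow> (f i)\<^sup>2 - f i \<in> ideal_in V B"
  shows "(prod f I)\<^sup>2 - prod f I \<in> ideal_in V B"
  using assms
proof (induction I rule: infinite_finite_induct)
  case (insert i I)
  then show ?case
    by (simp add: mult_idempotent_in_ideal_in prod_in_polys_in)
qed auto

lemma sum_orthogonal_idempotent_in_ideal_in: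
  assumes "finite I" "\<And>i. i \<in> I \<Longrightarrow> (f i)\<^sup>2 - f i \<in> ideal_in V B"
    and "\<And>i j. i \<in> I \<Longrightarrow> j \<in> I \<Longrightarrow> i \<noteq> j \<Longrightarrow> f i * f j \<in> ideal_in V B"
  shows "(sum f I)\<^sup>2 - sum f I \<in> ideal_in V B"
proof -
  have "(sum f I)\<^sup>2 - sum f I = (\<Sum>i\<in>I. (\<Sum>j\<in>I. f i * f j) - f i)"
    by (simp add: power2_eq_square sum_product sum_subtractf)
  \<comment> \<open>The diagonal term of each row joins \<open>- f i\<close>; the off-diagonal terms
    lie in the ideal by orthogonality.\<close>
  also have "\<dots> = (\<Sum>i\<in>I. ((f i)\<^sup>2 - f i) + (\<Sum>j\<in>I - {i}. f i * f j))"
    by (rule sum.cong) (simp_all add: assms(1) sum.remove power2_eq_square)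
  finally show ?thesis
    using assms by (auto intro!: sum_in_ideal_in add_in_ideal_in)
qed

subsection \<open>The literals and the monomials \<open>F j m\<close>\<close>

lemma x_flip: "i \<noteq> j \<Longrightarrow> x j i = 1 - x i j"
  by (auto simp: x_def)

lemma x_in_polys_in:
  "i \<in> {1..n} \<Longrightarrow> j \<in> {1..n} \<Longrightarrow> i \<noteq> j \<Longrightarrow> x i j \<in> polys_in (ord_vars n)"
  by (auto simp: x_def ord_vars_def intro!: var_in_polys_in diff_in_polys_in)

lemma F_in_polys_in: "j \<in> {1..m} \<Longrightarrow> m \<le> n \<Longrightarrow> F j m \<in> polys_in (ord_vars n)"
  unfolding F_def by (intro prod_in_polys_in x_in_polys_in) auto

lemma finite_boolean_axioms: "finite (boolean_axioms n)"
proof -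
  have "boolean_axioms n \<subseteq>
      (\<lambda>(i, j). (x i j)\<^sup>2 - x i j) ` ({1..n} \<times> {1..n}) \<union>
      (\<lambda>(i, j). x i j * x j i) ` ({1..n} \<times> {1..n})"
    unfolding boolean_axioms_def by auto
  then show ?thesis
    by (rule finite_subset) simp
qed

lemma finite_ORD: "finite (ORD n)"
proof -
  let ?I = "{(i, j, k). 1 \<le> i \<and> i < j \<and> j < k \<and> k \<le> n}"
  have "ORD n =
      (\<lambda>i. \<Prod>j\<in>{1..n} - {i}. x i j) ` {1..n} \<union>
      ((\<lambda>(i, j, k). x i j * x j k * x k i) ` ?I \<union> (\<lambda>(i, j, k). x k j * x j i * x i k) ` ?I)"
    unfolding ORD_def non_minimality_axioms_def transitivity_axioms_def
    by (intro arg_cong2[of _ _ _ _ "(\<union>)"]) (blast, (fast intro: rev_image_eqI)+)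
  moreover have "finite ?I"
    by (rule finite_subset[of _ "{1..n} \<times> {1..n} \<times> {1..n}"]) auto
  ultimately show ?thesis
    by simp
qed

lemma F_idempotent_in_ideal_in:
  assumes "j \<in> {1..m}" "m \<le> n"
  shows "(F j m)\<^sup>2 - F j m \<in> ideal_in (ord_vars n) (boolean_axioms n)"
  unfolding F_def
proof (rule prod_idempotent_in_ideal_in)
  fix i assume "i \<in> {1..m} - {j}"
  then have i: "i \<in> {1..n}" "j \<in> {1..n}" "j \<noteq> i"
    using assms by auto
  then show "x j i \<in> polys_in (ord_vars n)"
    by (rule_tac x_in_polys_in)
  have "(x j i)\<^sup>2 - x j i \<in> boolean_axioms n"
    using i unfolding boolean_axioms_def by blast
  then show "(x j i)\<^sup>2 - x j i \<in> ideal_in (ord_vars n) (boolean_axioms n)"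
    by (intro generator_in_ideal_in finite_boolean_axioms)
qed

text \<open>Isolates the literal comparing \<open>j\<close> with \<open>k\<close>. It meets its
  complement in \<open>F_orthogonal_in_ideal_in\<close>, is the new factor in \<open>F_Suc\<close>,
  and completes the cycle in \<open>T_multiple_of_transitivity_axiom\<close>.\<close>

lemma F_split:
  assumes "k \<in> {1..m}" "k \<noteq> j"
  shows "F j m = x j k * (\<Prod>i\<in>{1..m} - {j, k}. x j i)"
proof -
  have "{1..m} - {j, k} = ({1..m} - {j}) - {k}"
    by auto
  then show ?thesis
    using assms prod.remove[of "{1..m} - {j}" k "x j"] by (simp add: F_def)
qed

text \<open>Two distinct elements cannot both be minimal in \<open>{1..m}\<close>: the product
  contains \<open>x j k * x k j\<close>, a Boolean axiom.\<close>

lemma F_orthogonal_in_ideal_in: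
  assumes "j \<in> {1..m}" "k \<in> {1..m}" "j \<noteq> k" "m \<le> n"
  shows "F j m * F k m \<in> ideal_in (ord_vars n) (boolean_axioms n)"
proof -
  have "F j m * F k m =
      (\<Prod>i\<in>{1..m} - {j, k}. x j i) * (\<Prod>i\<in>{1..m} - {k, j}. x k i) * (x j k * x k j)"
    using assms by (simp add: F_split[of k m j] F_split[of j m k] ac_simps)
  moreover have "(\<Prod>i\<in>{1..m} - {j, k}. x j i) \<in> polys_in (ord_vars n)"
    "(\<Prod>i\<in>{1..m} - {k, j}. x k i) \<in> polys_in (ord_vars n)"
    using assms by (auto intro!: prod_in_polys_in x_in_polys_in)
  moreover have "j \<in> {1..n}" "k \<in> {1..n}"
    using assms by auto
  then have "x j k * x k j \<in> boolean_axioms n"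
    using assms(3) unfolding boolean_axioms_def by blast
  ultimately show ?thesis
    by (simp only: mult_in_ideal_in mult_in_polys_in generator_in_ideal_in finite_boolean_axioms)
qed

text \<open>On 0/1 assignments \<open>g\<close> is the indicator that \<open>m + 1\<close> lies
  below all of \<open>{1..m}\<close> while \<open>{1..m}\<close> has no minimal element, so squaring
  does not change it.\<close>

lemma square_cong:
  assumes "1 \<le> m" "m < n"
  defines "g \<equiv> F (m + 1) (m + 1) - (\<Sum>j = 1..m. F j m * F (m + 1) (m + 1))"
  shows "g\<^sup>2 - g \<in> ideal_in (ord_vars n) (boolean_axioms n)"
proof -
  define S where "S = (\<Sum>j = 1..m. F j m)"
  have S: "S\<^sup>2 - S \<in> ideal_in (ord_vars n) (boolean_axioms n)"
    unfolding S_def using assms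
    by (intro sum_orthogonal_idempotent_in_ideal_in F_idempotent_in_ideal_in
        F_orthogonal_in_ideal_in) auto
  have "(1 - S)\<^sup>2 - (1 - S) = S\<^sup>2 - S"
    by (simp add: algebra_simps power2_eq_square)
  then have "(1 - S)\<^sup>2 - (1 - S) \<in> ideal_in (ord_vars n) (boolean_axioms n)"
    using S by (simp only:)
  moreover have "g = F (m + 1) (m + 1) * (1 - S)"
    by (simp add: g_def S_def algebra_simps sum_distrib_left)
  moreover have "S \<in> polys_in (ord_vars n)"
    unfolding S_def using assms by (intro sum_in_polys_in F_in_polys_in) auto
  ultimately show ?thesis
    using assms(1,2)
    by (simp only:) (intro mult_idempotent_in_ideal_in F_idempotent_in_ideal_in F_in_polys_in
        diff_in_polys_in one_in_polys_in; simp)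
qed

subsection \<open>The polynomial identity\<close>

text \<open>The summand at \<open>k\<close> is the drop of the partial product when the factor
  \<open>a k\<close> joins it. For 0/1 values it indicates that \<open>k\<close> is the first index
  other than \<open>j\<close> with \<open>a k = 0\<close>.\<close>

lemma sum_telescope_prod:
  fixes a :: "nat \<Rightarrow> 'a :: comm_ring_1"
  shows "(\<Sum>k\<in>{1..m} - {j}. (1 - a k) * (\<Prod>i\<in>{1..k - 1} - {j}. a i)) = 1 - (\<Prod>i\<in>{1..m} - {j}. a i)"
proof (induction m)
  case (Suc m)
  \<comment> \<open>If the new index is \<open>j\<close> itself, neither side changes.\<close>
  have "{1..Suc m} - {j} = (if Suc m = j then {1..m} - {j} else insert (Suc m) ({1..m} - {j}))"
    by auto
  then show ?case
    using Suc by (cases "Suc m = j") (simp_all add: algebra_simps)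
qed simp

lemma sum_T:
  assumes "j \<in> {1..m}"
  shows "(\<Sum>k\<in>{1..m} - {j}. T j m k) = F j m * x (m + 1) j - F j m * F (m + 1) (m + 1)"
proof -
  have "(\<Sum>k\<in>{1..m} - {j}. T j m k) = F j m * x (m + 1) j *
      (\<Sum>k\<in>{1..m} - {j}. (1 - x (m + 1) k) * (\<Prod>i\<in>{1..k - 1} - {j}. x (m + 1) i))"
    unfolding sum_distrib_left
    \<comment> \<open>Flipping only literals whose second index is a successor turns
      \<open>x k (m + 1)\<close> into \<open>1 - x (m + 1) k\<close> and leaves the literals
      \<open>x (m + 1) i\<close> alone.\<close>
    by (rule sum.cong) (auto simp: T_def x_flip[of "m + 1" for m, simplified] ac_simps)
  also have "\<dots> = F j m * x (m + 1) j * (1 - (\<Prod>i\<in>{1..m} - {j}. x (m + 1) i))"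
    by (simp only: sum_telescope_prod)
  also have "{1..m + 1} - {m + 1} = {1..m}"
    by auto
  \<comment> \<open>With the factor at \<open>j\<close> split off, the product over the other
    indices is exactly the one left by the telescoping.\<close>
  then have "F (m + 1) (m + 1) = x (m + 1) j * (\<Prod>i\<in>{1..m} - {j}. x (m + 1) i)"
    using assms prod.remove[of "{1..m}" j "x (m + 1)"] by (simp add: F_def)
  then have "F j m * x (m + 1) j * (1 - (\<Prod>i\<in>{1..m} - {j}. x (m + 1) i)) =
      F j m * x (m + 1) j - F j m * F (m + 1) (m + 1)"
    by (simp add: algebra_simps)
  finally show ?thesis .
qed

lemma F_Suc:
  assumes "j \<in> {1..m}"
  shows "F j (m + 1) = F j m - F j m * x (m + 1) j"
proof -
  have "{1..m + 1} - {j, m + 1} = {1..m} - {j}"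
    by auto
  then show ?thesis
    using assms F_split[of "m + 1" "m + 1" j] x_flip[of "m + 1" j]
    by (simp add: F_def left_diff_distrib mult.commute)
qed

text \<open>The terms \<open>F j m * F (m + 1) (m + 1)\<close> cancel, and the remaining
  \<open>F (m + 1) (m + 1)\<close> is the summand \<open>j = m + 1\<close> of the larger
  sum.\<close>

lemma increment_identity:
  "F (m + 1) (m + 1) - (\<Sum>j = 1..m. F j m * F (m + 1) (m + 1))
     - (\<Sum>j = 1..m. \<Sum>k\<in>{1..m} - {j}. T j m k)
   = (\<Sum>j = 1..m + 1. F j (m + 1)) - (\<Sum>j = 1..m. F j m)"
proof -
  have "(\<Sum>j = 1..m. \<Sum>k\<in>{1..m} - {j}. T j m k) =
      (\<Sum>j = 1..m. F j m - F j (m + 1) - F j m * F (m + 1) (m + 1))"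
    by (rule sum.cong) (simp_all only: sum_T F_Suc, simp)
  then show ?thesis
    by (simp add: sum_subtractf)
qed

lemma telescoped_identity:
  assumes "n \<ge> 1"
  shows "(\<Sum>m = 1..n - 1. F (m + 1) (m + 1) - (\<Sum>j = 1..m. F j m * F (m + 1) (m + 1))
       - (\<Sum>j = 1..m. \<Sum>k\<in>{1..m} - {j}. T j m k)) - (\<Sum>j = 1..n. F j n) = - 1"
  using assms
proof (induction n rule: dec_induct)
  case base
  \<comment> \<open>For \<open>n = 1\<close> the sum over \<open>m\<close> is empty and
    \<open>F 1 1\<close> is the empty product 1.\<close>
  show ?case
    by (simp add: F_def)
next
  case (step n)
  then have "{1..Suc n - 1} = insert n {1..n - 1}" "n \<notin> {1..n - 1}"
    by auto
  then show ?case
    using step.IH increment_identity[of n] by (simp add: algebra_simps)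
qed

subsection \<open>Multiples of transitivity axioms\<close>

lemma literal_monomial_one: "literal_monomial n 1"
  unfolding literal_monomial_def by (intro exI[of _ "\<lambda>_ _. 0"]) simp

lemma literal_monomial_mult:
  assumes "literal_monomial n M" "literal_monomial n N"
  shows "literal_monomial n (M * N)"
proof -
  obtain d e :: "nat \<Rightarrow> nat \<Rightarrow> nat" where
    "M = (\<Prod>i\<in>{1..n}. \<Prod>j\<in>{1..n} - {i}. x i j ^ d i j)"
    "N = (\<Prod>i\<in>{1..n}. \<Prod>j\<in>{1..n} - {i}. x i j ^ e i j)"
    using assms unfolding literal_monomial_def by blast
  then show ?thesis
    unfolding literal_monomial_def
    by (intro exI[of _ "\<lambda>i j. d i j + e i j"]) (simp add: power_add prod.distrib)
qed

lemma literal_monomial_x: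
  assumes "i \<in> {1..n}" "j \<in> {1..n}" "i \<noteq> j"
  shows "literal_monomial n (x i j)"
proof -
  have "(\<Prod>i'\<in>{1..n}. \<Prod>j'\<in>{1..n} - {i'}. x i' j' ^ (if i' = i \<and> j' = j then 1 else 0))
      = (\<Prod>i'\<in>{1..n}. if i' = i then x i j else 1)"
  proof (rule prod.cong)
    fix i'
    show "(\<Prod>j'\<in>{1..n} - {i'}. x i' j' ^ (if i' = i \<and> j' = j then 1 else 0)) =
        (if i' = i then x i j else 1)"
      using assms by (simp add: if_distrib[of "\<lambda>t. _ ^ t"] cong: if_cong)
  qed simp
  also have "\<dots> = x i j"
    using assms by simp
  finally show ?thesis
    unfolding literal_monomial_def
    by (intro exI[of _ "\<lambda>i' j'. if i' = i \<and> j' = j then 1 else 0"]) (rule sym)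
qed

lemma literal_monomial_prod:
  "(\<And>i. i \<in> I \<Longrightarrow> literal_monomial n (f i)) \<Longrightarrow> literal_monomial n (prod f I)"
  by (induction I rule: infinite_finite_induct)
    (auto intro: literal_monomial_mult literal_monomial_one)

lemma literal_monomial_in_polys_in:
  "literal_monomial n M \<Longrightarrow> M \<in> polys_in (ord_vars n)"
  unfolding literal_monomial_def
  by (auto intro!: prod_in_polys_in power_in_polys_in x_in_polys_in)

text \<open>Since \<open>k\<close> differs from \<open>j\<close>, \<open>F j m\<close> contains
  \<open>x j k\<close>, which closes the cycle \<open>m + 1\<close>, \<open>j\<close>,
  \<open>k\<close> with the other two literals. The largest index is \<open>m + 1\<close>, so the
  order of \<open>j\<close> and \<open>k\<close> decides which family of axioms applies.\<close>

lemma T_multiple_of_transitivity_axiom: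
  assumes "m \<in> {1..n - 1}" "j \<in> {1..m}" "k \<in> {1..m} - {j}"
  shows "\<exists>M. \<exists>p\<in>transitivity_axioms n. literal_monomial n M \<and> T j m k = M * p"
proof (intro exI bexI conjI)
  let ?p = "x (m + 1) j * x j k * x k (m + 1)"
  let ?M = "(\<Prod>i\<in>{1..m} - {j, k}. x j i) * (\<Prod>i\<in>{1..k - 1} - {j}. x (m + 1) i)"
  show "literal_monomial n ?M"
    using assms by (intro literal_monomial_mult literal_monomial_prod literal_monomial_x) auto
  show "T j m k = ?M * ?p"
    using assms F_split[of k m j] by (simp add: T_def ac_simps)
  show "?p \<in> transitivity_axioms n"
  proof (cases "j < k")
    case True
    then have "?p = x j k * x k (m + 1) * x (m + 1) j" "1 \<le> j" "k < m + 1" "m + 1 \<le> n"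
      using assms by (auto simp: ac_simps)
    then show ?thesis
      using True unfolding transitivity_axioms_def by blast
  next
    case False
    then have "1 \<le> k" "k < j" "j < m + 1" "m + 1 \<le> n"
      using assms by auto
    then show ?thesis
      unfolding transitivity_axioms_def by blast
  qed
qed

section \<open>Assembly of the congruence and the sum of squares certificate\<close>

theorem theorem5:
  fixes n :: nat
  assumes "n \<ge> 1"
  shows
    "cong_modulo (ord_vars n) (boolean_axioms n) (- 1)
       ((\<Sum>m = 1..n - 1.
           ((F (m + 1) (m + 1) - (\<Sum>j = 1..m. F j m * F (m + 1) (m + 1)))\<^sup>2
            - (\<Sum>j = 1..m. \<Sum>k\<in>{1..m} - {j}. T j m k)))
        - (\<Sum>j = 1..n. F j n))
     \<and> (\<forall>m\<in>{1..n - 1}. \<forall>j\<in>{1..m}. \<forall>k\<in>{1..m} - {j}.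
          \<exists>M. \<exists>p\<in>transitivity_axioms n. literal_monomial n M \<and> T j m k = M * p)
     \<and> (\<forall>j\<in>{1..n}. F j n \<in> non_minimality_axioms n)
     \<and> (\<exists>q. sos_proof (ord_vars n) (boolean_axioms n) (ORD n) q
               (map (\<lambda>m. F (m + 1) (m + 1) - (\<Sum>j = 1..m. F j m * F (m + 1) (m + 1))) [1..<n])
             \<and> (\<Sum>p\<in>ORD n. p * q p) =
                 - (\<Sum>m = 1..n - 1. \<Sum>j = 1..m. \<Sum>k\<in>{1..m} - {j}. T j m k)
                 - (\<Sum>j = 1..n. F j n))"
proof -
  let ?V = "ord_vars n" and ?B = "boolean_axioms n"
  let ?g = "\<lambda>m. F (m + 1) (m + 1) - (\<Sum>j = 1..m. F j m * F (m + 1) (m + 1))"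
  let ?t = "\<lambda>m. \<Sum>j = 1..m. \<Sum>k\<in>{1..m} - {j}. T j m k"
  let ?R = "(\<Sum>m = 1..n - 1. (?g m)\<^sup>2 - ?t m) - (\<Sum>j = 1..n. F j n)"
  \<comment> \<open>Replacing \<open>- 1\<close> by the exact identity, in which \<open>?g m\<close>
    is not squared, cancels every \<open>T j m k\<close> and \<open>F j n\<close>.\<close>
  have "- 1 - ?R = - (\<Sum>m = 1..n - 1. (?g m)\<^sup>2 - ?g m)"
    unfolding telescoped_identity[OF assms, symmetric] by (simp add: sum_subtractf)
  also have "\<dots> \<in> ideal_in ?V ?B"
    by (intro uminus_in_ideal_in sum_in_ideal_in square_cong) auto
  finally have cong: "cong_modulo ?V ?B (- 1) ?R"
    by (simp only: cong_modulo_iff)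
  have trans: "\<exists>M. \<exists>p\<in>transitivity_axioms n. literal_monomial n M \<and> T j m k = M * p"
    if "m \<in> {1..n - 1}" "j \<in> {1..m}" "k \<in> {1..m} - {j}" for m j k
    using that by (rule T_multiple_of_transitivity_axiom)
  have nonmin: "F j n \<in> non_minimality_axioms n" if "j \<in> {1..n}" for j
    using that unfolding non_minimality_axioms_def F_def by blast
  have T: "T j m k \<in> ideal_in ?V (ORD n)"
    if m: "m \<in> {1..n - 1}" and j: "j \<in> {1..m}" and k: "k \<in> {1..m} - {j}" for m j k
  proof -
    obtain M p where "p \<in> transitivity_axioms n" "literal_monomial n M" "T j m k = M * p"
      using trans[OF m j k] by blast
    moreover from this have "p \<in> ORD n"
      by (simp add: ORD_def)
    ultimately show ?thesis
      by (simp add: finite_ORD mult_in_ideal_in literal_monomial_in_polys_in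
          generator_in_ideal_in)
  qed
  have "F j n \<in> ideal_in ?V (ORD n)" if "j \<in> {1..n}" for j
    using nonmin[OF that] by (intro generator_in_ideal_in finite_ORD) (simp add: ORD_def)
  then have "- (\<Sum>m = 1..n - 1. ?t m) - (\<Sum>j = 1..n. F j n) \<in> ideal_in ?V (ORD n)"
    by (intro diff_in_ideal_in uminus_in_ideal_in sum_in_ideal_in T)
  \<comment> \<open>The multipliers are read off from ideal membership of the whole non-square part,
    so no explicit formula for them is required.\<close>
  then obtain q where q: "\<forall>p\<in>ORD n. q p \<in> polys_in ?V"
      "(\<Sum>p\<in>ORD n. p * q p) = - (\<Sum>m = 1..n - 1. ?t m) - (\<Sum>j = 1..n. F j n)"
    unfolding ideal_in_def by (smt (verit) mem_Collect_eq)
  have g: "set (map ?g [1..<n]) \<subseteq> polys_in ?V"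
    by (auto intro!: diff_in_polys_in sum_in_polys_in mult_in_polys_in F_in_polys_in)
  have "{1..<n} = {1..n - 1}"
    using assms by auto
  \<comment> \<open>The list of indices is distinct, so summing along it agrees with summing over
    the set; the polynomials \<open>?g m\<close> themselves need not be distinct.\<close>
  then have "(\<Sum>g\<leftarrow>map ?g [1..<n]. g\<^sup>2) = (\<Sum>m = 1..n - 1. (?g m)\<^sup>2)"
    by (simp add: sum_list_distinct_conv_sum_set comp_def)
  then have "(\<Sum>p\<in>ORD n. p * q p) + (\<Sum>g\<leftarrow>map ?g [1..<n]. g\<^sup>2) = ?R"
    by (simp only: q(2) sum_subtractf) simp
  then have "sos_proof ?V ?B (ORD n) q (map ?g [1..<n])"
    unfolding sos_proof_def using q(1) g cong by simp
  then show ?thesis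
    using cong trans nonmin q(2) by blast
qed

end
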